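(* Let $n\ge 1$ and let $T: S_n(\mathbb{R})\to S_n(\mathbb{R})$ be a linear operator preserving positive definiteness. Then the condition $T^{-1}(\mathcal{A})\subset\mathcal{A}$ is equivalent to each one of the following conditions: (1) $T^{-1}(\mathcal{C})\subset\mathcal{C}$, where $\mathcal{C}$ is the set of all invertible matrices in $S_n(\mathbb{R})$ (i.e. $T$ preserves singularity); (2) $T$ preserves the set of all singular, positive semi-definite symmetric matrices, i.e. if $A\in S_n(\mathbb{R})$ is singular and positive semi-definite, then $T(A)$ is singular and positive semi-definite; (3) $T(\mathcal{A})=\mathcal{A}$.
   Context: $S_n(\mathbb{R})$ is the real vector space of real symmetric $n\times n$ matrices. $\mathcal{A}\subset S_n(\mathbb{R})$ is the set of all positive definite symmetric matrices. $T$ preserves positive definiteness if $T(A)\in\mathcal{A}$ whenever $A\in\mathcal{A}$. For a subset $\mathcal{S}\subset S_n(\mathbb{R})$, $T^{-1}(\mathcal{S})=\{A\in S_n(\mathbb{R}): T(A)\in\mathcal{S}\}$ denotes the preimage. *)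

theory Defs
  imports "HOL-Analysis.Analysis"
begin

definition sym_mats :: "(real^'n^'n) set" where
  "sym_mats = {A. transpose A = A}"

definition pos_def_mats :: "(real^'n^'n) set" where
  "pos_def_mats = {A \<in> sym_mats. \<forall>x. x \<noteq> 0 \<longrightarrow> x \<bullet> (A *v x) > 0}"

definition pos_semidef_mats :: "(real^'n^'n) set" where
  "pos_semidef_mats = {A \<in> sym_mats. \<forall>x. x \<bullet> (A *v x) \<ge> 0}"

definition invertible_sym_mats :: "(real^'n^'n) set" where
  "invertible_sym_mats = {A \<in> sym_mats. invertible A}"

text \<open>
  An operator on symmetric matrices is a function on all square matrices of which only the
  restriction to \<^const>\<open>sym_mats\<close> matters. In particular, preimages are taken within
  \<^const>\<open>sym_mats\<close>.
\<close>

definition linear_on_sym :: "(real^'n^'n \<Rightarrow> real^'n^'n) \<Rightarrow> bool" where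
  "linear_on_sym T \<longleftrightarrow>
     (\<forall>A\<in>sym_mats. T A \<in> sym_mats) \<and>
     (\<forall>A\<in>sym_mats. \<forall>B\<in>sym_mats. T (A + B) = T A + T B) \<and>
     (\<forall>c. \<forall>A\<in>sym_mats. T (c *\<^sub>R A) = c *\<^sub>R T A)"

definition sym_preimage :: "(real^'n^'n \<Rightarrow> real^'n^'n) \<Rightarrow> (real^'n^'n) set \<Rightarrow> (real^'n^'n) set" where
  "sym_preimage T S = {A \<in> sym_mats. T A \<in> S}"

definition preserves_pos_def :: "(real^'n^'n \<Rightarrow> real^'n^'n) \<Rightarrow> bool" where
  "preserves_pos_def T \<longleftrightarrow> (\<forall>A\<in>pos_def_mats. T A \<in> pos_def_mats)"

end

theory Submission
  imports Defs
begin

text \<open>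
  If \<open>m\<close> is the least value of the quadratic form of \<open>A\<close> on the unit sphere, then
  \<open>A - m I\<close> is singular and positive semi-definite. For \<open>A\<close> not positive definite we have
  \<open>m \<le> 0\<close>, so \<open>T (A - m I)\<close> is positive definite as soon as \<open>T A\<close> is; this contradicts
  (1) as well as (2).

  Conversely, the condition on preimages makes \<open>T\<close> a linear automorphism of the cone of positive
  semi-definite matrices, which gives (2) and (3). An automorphism maps extreme rays to extreme rays,
  that is, matrices \<open>w w\<^sup>t\<close> to matrices of rank at most one. A symmetric matrix of rank \<open>r\<close> is a
  linear combination of \<open>r\<close> matrices \<open>w w\<^sup>t\<close>, so \<open>T\<close> does not increase the rank, and (1) follows.
\<close>

section \<open>Symmetric and positive semi-definite matrices\<close>

lemma sym_mats_add: "A \<in> sym_mats \<Longrightarrow> B \<in> sym_mats \<Longrightarrow> A + B \<in> sym_mats"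
  by (simp add: sym_mats_def transpose_def vec_eq_iff)

lemma sym_mats_scaleR: "A \<in> sym_mats \<Longrightarrow> c *\<^sub>R A \<in> sym_mats"
  by (simp add: sym_mats_def transpose_def vec_eq_iff)

lemma sym_mats_diff: "A \<in> sym_mats \<Longrightarrow> B \<in> sym_mats \<Longrightarrow> A - B \<in> sym_mats"
  by (simp add: sym_mats_def transpose_def vec_eq_iff)

lemma zero_sym_mats: "0 \<in> sym_mats"
  by (simp add: sym_mats_def transpose_def vec_eq_iff)

lemma sym_mats_mat: "mat c \<in> sym_mats"
  by (simp add: sym_mats_def)

lemma sym_mats_inner: "A \<in> sym_mats \<Longrightarrow> x \<bullet> (A *v y) = (A *v x) \<bullet> y"
  by (metis (mono_tags) dot_lmul_matrix mem_Collect_eq sym_mats_def transpose_matrix_vector)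

lemma sym_mats_inner_commute: "A \<in> sym_mats \<Longrightarrow> x \<bullet> (A *v y) = y \<bullet> (A *v x)"
  by (metis sym_mats_inner inner_commute)

lemma pos_def_imp_sym: "A \<in> pos_def_mats \<Longrightarrow> A \<in> sym_mats"
  by (simp add: pos_def_mats_def)

lemma pos_semidef_imp_sym: "A \<in> pos_semidef_mats \<Longrightarrow> A \<in> sym_mats"
  by (simp add: pos_semidef_mats_def)

lemma pos_def_imp_pos_semidef: "A \<in> pos_def_mats \<Longrightarrow> A \<in> pos_semidef_mats"
  unfolding pos_def_mats_def pos_semidef_mats_def
  by (auto simp: less_eq_real_def) (metis inner_zero_left)

lemma pos_def_one: "mat 1 \<in> pos_def_mats"
  by (simp add: pos_def_mats_def sym_mats_mat)

lemma pos_semidef_add_pos_def: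
  assumes "A \<in> pos_semidef_mats" "B \<in> pos_def_mats"
  shows "A + B \<in> pos_def_mats"
  using assms unfolding pos_semidef_mats_def pos_def_mats_def
  by (auto simp: sym_mats_add matrix_vector_mult_add_rdistrib inner_add_right
      intro: add_nonneg_pos)

lemma pos_def_scaleR: "A \<in> pos_def_mats \<Longrightarrow> c > 0 \<Longrightarrow> c *\<^sub>R A \<in> pos_def_mats"
  by (simp add: pos_def_mats_def sym_mats_scaleR scaleR_matrix_vector_assoc [symmetric])

lemma invertible_iff_kernel:
  fixes A :: "real^'n^'n"
  shows "invertible A \<longleftrightarrow> (\<forall>x. A *v x = 0 \<longrightarrow> x = 0)"
  by (simp add: invertible_left_inverse matrix_left_invertible_ker)

text \<open>The usual discriminant argument: the form of \<open>B\<close> along the line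
  \<open>x + t *\<^sub>R u\<close> is a polynomial of degree at most two in \<open>t\<close> that is
  never negative.\<close>

lemma pos_semidef_cauchy_schwarz:
  assumes "B \<in> pos_semidef_mats"
  shows "(x \<bullet> (B *v u))\<^sup>2 \<le> (x \<bullet> (B *v x)) * (u \<bullet> (B *v u))"
proof -
  define a b c where "a = x \<bullet> (B *v x)" and "b = x \<bullet> (B *v u)" and "c = u \<bullet> (B *v u)"
  have "u \<bullet> (B *v x) = b"
    using sym_mats_inner_commute [OF pos_semidef_imp_sym [OF assms]] by (simp add: b_def)
  then have expand: "(x + t *\<^sub>R u) \<bullet> (B *v (x + t *\<^sub>R u)) = a + 2 * t * b + t\<^sup>2 * c" for t
    by (simp add: a_def b_def c_def matrix_vector_right_distrib matrix_vector_mult_scaleR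
        inner_add_left inner_add_right algebra_simps power2_eq_square)
  have nonneg: "0 \<le> a + 2 * t * b + t\<^sup>2 * c" for t
    using assms unfolding expand [symmetric] by (simp add: pos_semidef_mats_def)
  have "c \<ge> 0"
    using assms by (simp add: c_def pos_semidef_mats_def)
  show ?thesis
  proof (cases "c = 0")
    case True
    have "b = 0"
    proof (rule ccontr)
      assume "b \<noteq> 0"
      \<comment> \<open>With \<open>c = 0\<close> the polynomial is affine; this \<open>t\<close>
        would give it the value \<open>-1\<close>.\<close>
      then have "2 * (- (a + 1) / (2 * b)) * b = - (a + 1)"
        by simp
      then show False
        using nonneg [of "- (a + 1) / (2 * b)"] True by simp
    qed
    then show ?thesis
      using True by (simp add: b_def c_def)
  next
    case False
    with \<open>c \<ge> 0\<close> have "c > 0" by simp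
    \<comment> \<open>The polynomial attains its minimum at \<open>t = - b / c\<close>.\<close>
    then have "a + 2 * (- b / c) * b + (- b / c)\<^sup>2 * c = a - b\<^sup>2 / c"
      by (simp add: field_simps power2_eq_square)
    then have "b\<^sup>2 / c \<le> a"
      using nonneg [of "- b / c"] by simp
    with \<open>c > 0\<close> have "b\<^sup>2 \<le> a * c"
      by (simp add: field_simps)
    then show ?thesis
      by (simp add: a_def b_def c_def)
  qed
qed

text \<open>Cauchy-Schwarz with \<open>x = B *v u\<close> bounds the square of
  \<open>(B *v u) \<bullet> (B *v u)\<close> by zero. Hence an isotropic vector of a positive
  semi-definite form is a kernel vector.\<close>

lemma pos_semidef_kernel:
  assumes "B \<in> pos_semidef_mats" "u \<bullet> (B *v u) = 0"
  shows "B *v u = 0"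
  using pos_semidef_cauchy_schwarz [OF assms(1), of "B *v u" u] assms(2) by simp

lemma pos_def_iff: "A \<in> pos_def_mats \<longleftrightarrow> A \<in> pos_semidef_mats \<and> invertible A"
proof
  assume A: "A \<in> pos_def_mats"
  then show "A \<in> pos_semidef_mats \<and> invertible A"
    unfolding invertible_iff_kernel
    by (auto simp: pos_def_imp_pos_semidef) (force simp: pos_def_mats_def)
next
  assume A: "A \<in> pos_semidef_mats \<and> invertible A"
  have "0 < x \<bullet> (A *v x)" if "x \<noteq> 0" for x
  proof -
    have "A *v x \<noteq> 0"
      using A that by (simp add: invertible_iff_kernel) blast
    then have "x \<bullet> (A *v x) \<noteq> 0"
      using A pos_semidef_kernel by blast
    then show ?thesis
      using A by (simp add: pos_semidef_mats_def less_le)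
  qed
  then show "A \<in> pos_def_mats"
    using A by (simp add: pos_def_mats_def pos_semidef_imp_sym)
qed

section \<open>Shifts by multiples of the identity\<close>

lemma singular_pos_semidef_shift:
  fixes A :: "real^'n^'n"
  assumes "A \<in> sym_mats"
  obtains m where "A - m *\<^sub>R mat 1 \<in> pos_semidef_mats" "\<not> invertible (A - m *\<^sub>R mat 1)"
proof -
  have "continuous_on (sphere 0 1) (\<lambda>x. x \<bullet> (A *v x))"
    by (intro continuous_intros matrix_vector_mult_linear_continuous_on)
  moreover have "sphere 0 1 \<noteq> ({} :: (real^'n) set)"
    by simp
  ultimately have "\<exists>x0\<in>sphere 0 1. \<forall>x\<in>sphere 0 1. x0 \<bullet> (A *v x0) \<le> x \<bullet> (A *v x)"
    by (intro continuous_attains_inf compact_sphere)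
  then obtain x0 where x0: "norm x0 = 1"
    and min: "\<And>x. norm x = 1 \<Longrightarrow> x0 \<bullet> (A *v x0) \<le> x \<bullet> (A *v x)"
    by auto
  define m where "m = x0 \<bullet> (A *v x0)"
  define B where "B = A - m *\<^sub>R mat 1"
  have form: "x \<bullet> (B *v x) = x \<bullet> (A *v x) - m * (x \<bullet> x)" for x
    by (simp add: B_def matrix_vector_mult_diff_rdistrib inner_diff_right
        scaleR_matrix_vector_assoc [symmetric])
  have "0 \<le> x \<bullet> (B *v x)" for x
  proof (cases "x = 0")
    case False
    \<comment> \<open>The bound is known on the unit sphere only; homogeneity of degree two carries
      it to all nonzero vectors.\<close>
    then have "m \<le> (x /\<^sub>R norm x) \<bullet> (A *v (x /\<^sub>R norm x))"
      unfolding m_def by (intro min) simp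
    also have "\<dots> = (x \<bullet> (A *v x)) / (x \<bullet> x)"
      by (simp add: matrix_vector_mult_scaleR power2_norm_eq_inner [symmetric]
          power2_eq_square field_simps)
    finally show ?thesis
      using False by (simp add: form field_simps)
  qed simp
  then have psd: "B \<in> pos_semidef_mats"
    using assms by (simp add: pos_semidef_mats_def B_def sym_mats_diff sym_mats_scaleR sym_mats_mat)
  \<comment> \<open>The minimizer is isotropic for \<open>B\<close>, hence a nonzero kernel
    vector.\<close>
  have "x0 \<bullet> (B *v x0) = 0"
    using x0 by (simp add: form m_def norm_eq_1)
  then have "B *v x0 = 0"
    by (rule pos_semidef_kernel [OF psd])
  with x0 have "\<not> invertible B"
    by (auto simp: invertible_iff_kernel)
  with psd show ?thesis
    using that by (simp add: B_def)
qed

text \<open>A large multiple of the identity makes \<open>A\<close> positive definite. The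
  decomposition lets surjectivity on the cone extend to all symmetric matrices.\<close>

lemma sym_mats_eq_diff_pos_def:
  assumes "A \<in> sym_mats"
  obtains B C where "B \<in> pos_def_mats" "C \<in> pos_def_mats" "A = B - C"
proof -
  obtain m where "A - m *\<^sub>R mat 1 \<in> pos_semidef_mats"
    using singular_pos_semidef_shift [OF assms] .
  \<comment> \<open>The coefficient is at least 1 whatever the sign of \<open>m\<close>, and it
    turns the shift by \<open>- m\<close> into one by \<open>\<bar>m\<bar> + 1\<close>.\<close>
  moreover have "(\<bar>m\<bar> + m + 1) *\<^sub>R mat 1 \<in> pos_def_mats"
    by (intro pos_def_scaleR pos_def_one) simp
  ultimately have "(A - m *\<^sub>R mat 1) + (\<bar>m\<bar> + m + 1) *\<^sub>R mat 1 \<in> pos_def_mats"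
    by (rule pos_semidef_add_pos_def)
  moreover have "(\<bar>m\<bar> + 1) *\<^sub>R mat 1 \<in> pos_def_mats"
    by (intro pos_def_scaleR pos_def_one) simp
  moreover have "A = ((A - m *\<^sub>R mat 1) + (\<bar>m\<bar> + m + 1) *\<^sub>R mat 1) - (\<bar>m\<bar> + 1) *\<^sub>R mat 1"
    by (simp add: algebra_simps)
  ultimately show ?thesis
    using that by blast
qed

text \<open>The positive semi-definite cone is closed: for each vector, let \<open>e\<close> tend to
  0 from the right.\<close>

lemma pos_semidef_if_perturbation:
  assumes "A \<in> sym_mats" "\<And>e. e > 0 \<Longrightarrow> A + e *\<^sub>R B \<in> pos_semidef_mats"
  shows "A \<in> pos_semidef_mats"
proof -
  have "0 \<le> x \<bullet> (A *v x)" for x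
  proof (rule tendsto_lowerbound)
    show "((\<lambda>e. x \<bullet> (A *v x) + e * (x \<bullet> (B *v x))) \<longlongrightarrow> x \<bullet> (A *v x)) (at_right 0)"
      by (auto intro!: tendsto_eq_intros)
    have "0 \<le> x \<bullet> (A *v x) + e * (x \<bullet> (B *v x))" if "e > 0" for e
      using assms(2) [OF that]
      by (auto simp: pos_semidef_mats_def matrix_vector_mult_add_rdistrib inner_add_right
          scaleR_matrix_vector_assoc [symmetric])
    then show "\<forall>\<^sub>F e in at_right 0. 0 \<le> x \<bullet> (A *v x) + e * (x \<bullet> (B *v x))"
      by (auto simp: eventually_at_right_less intro: eventually_mono [OF eventually_at_right_less])
  qed simp
  then show ?thesis
    using assms(1) by (simp add: pos_semidef_mats_def)
qed

section \<open>Rank-one matrices\<close>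

text \<open>The matrix \<open>w w\<^sup>t\<close>; for nonzero \<open>w\<close> it spans an extreme
  ray of the positive semi-definite cone.\<close>

definition outer :: "real^'n \<Rightarrow> real^'n^'n" where
  "outer w = (\<chi> i j. w $ i * w $ j)"

lemma outer_mult_vec: "outer w *v x = (w \<bullet> x) *\<^sub>R w"
  by (simp add: outer_def matrix_vector_mult_def inner_vec_def vec_eq_iff sum_distrib_left
      mult_ac)

lemma outer_sym: "outer w \<in> sym_mats"
  by (simp add: outer_def sym_mats_def transpose_def vec_eq_iff mult.commute)

lemma outer_pos_semidef: "outer w \<in> pos_semidef_mats"
  by (simp add: pos_semidef_mats_def outer_sym outer_mult_vec inner_commute)

lemma inner_outer_mult_vec: "x \<bullet> (outer w *v x) = (w \<bullet> x)\<^sup>2"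
  by (simp add: outer_mult_vec power2_eq_square inner_commute)

text \<open>Squeezed between 0 and \<open>outer w\<close>, the form of \<open>Y\<close> vanishes on
  the orthogonal complement of \<open>w\<close>, so \<open>Y\<close> itself does. By symmetry its
  range then lies on the line of \<open>w\<close>, which leaves one free scalar.\<close>

lemma pos_semidef_le_outer:
  assumes Y: "Y \<in> pos_semidef_mats" and le: "outer w - Y \<in> pos_semidef_mats"
  obtains c where "Y = c *\<^sub>R outer w"
proof -
  have orth: "Y *v z = 0" if "w \<bullet> z = 0" for z
  proof -
    have "0 \<le> z \<bullet> ((outer w - Y) *v z)"
      using le by (simp add: pos_semidef_mats_def)
    then have "z \<bullet> (Y *v z) \<le> 0"
      by (simp add: matrix_vector_mult_diff_rdistrib inner_diff_right inner_outer_mult_vec that)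
    then have "z \<bullet> (Y *v z) = 0"
      using Y by (intro antisym) (auto simp: pos_semidef_mats_def)
    then show ?thesis
      by (rule pos_semidef_kernel [OF Y])
  qed
  define k where "k = w \<bullet> w"
  have Yv: "k *\<^sub>R (Y *v v) = (w \<bullet> v) *\<^sub>R (Y *v w)" for v
  proof -
    \<comment> \<open>The argument is \<open>k\<close> times the component of \<open>v\<close>
      orthogonal to \<open>w\<close>; scaling by \<open>k\<close> avoids a division while
      \<open>w = 0\<close> is still possible.\<close>
    have "Y *v (k *\<^sub>R v - (w \<bullet> v) *\<^sub>R w) = 0"
      by (rule orth) (simp add: k_def inner_diff_right)
    then show ?thesis
      by (simp add: matrix_vector_mult_diff_distrib matrix_vector_mult_scaleR)
  qed
  have Yw: "k *\<^sub>R (Y *v w) = (w \<bullet> (Y *v w)) *\<^sub>R w"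
  proof -
    have "v \<bullet> (k *\<^sub>R (Y *v w)) = v \<bullet> ((w \<bullet> (Y *v w)) *\<^sub>R w)" for v
    proof -
      have "v \<bullet> (k *\<^sub>R (Y *v w)) = w \<bullet> (k *\<^sub>R (Y *v v))"
        using sym_mats_inner_commute [OF pos_semidef_imp_sym [OF Y], of v w] by simp
      then show ?thesis
        by (simp only: Yv) (simp add: inner_commute)
    qed
    then show ?thesis
      using vector_eq_ldot by blast
  qed
  show ?thesis
  proof (cases "w = 0")
    case True
    then have "Y *v v = 0" for v
      by (simp add: orth)
    then have "Y = 0"
      by (simp add: matrix_eq)
    then show ?thesis
      using that [of 0] by simp
  next
    case False
    then have "k \<noteq> 0"
      by (simp add: k_def)
    define c where "c = (w \<bullet> (Y *v w)) / k\<^sup>2"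
    have "Y *v v = (c *\<^sub>R outer w) *v v" for v
    proof -
      have "k\<^sup>2 *\<^sub>R (Y *v v) = k *\<^sub>R ((w \<bullet> v) *\<^sub>R (Y *v w))"
        by (simp only: Yv [symmetric]) (simp add: power2_eq_square)
      also have "\<dots> = (w \<bullet> v) *\<^sub>R (k *\<^sub>R (Y *v w))"
        by (simp add: mult.commute)
      also have "\<dots> = k\<^sup>2 *\<^sub>R ((c *\<^sub>R outer w) *v v)"
        using \<open>k \<noteq> 0\<close>
        by (simp only: Yw) (simp add: c_def outer_mult_vec scaleR_matrix_vector_assoc [symmetric])
      finally show ?thesis
        using \<open>k \<noteq> 0\<close> by simp
    qed
    then show ?thesis
      using that [of c] by (simp add: matrix_eq)
  qed
qed

text \<open>The matrix \<open>(B u) (B u)\<^sup>t / (u \<bullet> B u)\<close> lies below \<open>B\<close> by the Cauchy-Schwarz inequality.\<close>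

lemma pos_semidef_extreme_imp_outer:
  assumes B: "B \<in> pos_semidef_mats"
    and extreme: "\<And>Y. Y \<in> pos_semidef_mats \<Longrightarrow> B - Y \<in> pos_semidef_mats \<Longrightarrow> \<exists>c. Y = c *\<^sub>R B"
  obtains c y where "B = c *\<^sub>R outer y"
proof (cases "B = 0")
  case True
  then show ?thesis
    using that [of 0] by simp
next
  case False
  then obtain u where u: "B *v u \<noteq> 0"
    by (metis matrix_eq matrix_vector_mult_0)
  define d where "d = u \<bullet> (B *v u)"
  have "d \<noteq> 0"
    using u pos_semidef_kernel [OF B] by (auto simp: d_def)
  then have "d > 0"
    using B by (simp add: d_def pos_semidef_mats_def less_le)
  define Y where "Y = (1 / d) *\<^sub>R outer (B *v u)"
  have form: "x \<bullet> (Y *v x) = (x \<bullet> (B *v u))\<^sup>2 / d" for x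
    by (simp add: Y_def scaleR_matrix_vector_assoc [symmetric] inner_outer_mult_vec inner_commute)
  have Ysym: "Y \<in> sym_mats"
    by (simp add: Y_def sym_mats_scaleR outer_sym)
  have "Y \<in> pos_semidef_mats"
    using \<open>d > 0\<close> by (simp add: pos_semidef_mats_def Ysym form)
  moreover have "B - Y \<in> pos_semidef_mats"
    using \<open>d > 0\<close> pos_semidef_cauchy_schwarz [OF B, of _ u]
    by (simp add: pos_semidef_mats_def sym_mats_diff Ysym pos_semidef_imp_sym [OF B] form
        matrix_vector_mult_diff_rdistrib inner_diff_right d_def [symmetric] field_simps)
  ultimately obtain c where c: "Y = c *\<^sub>R B"
    using extreme by blast
  \<comment> \<open>Evaluation at \<open>u\<close> rules out \<open>c = 0\<close>, so that
    \<open>Y = c *\<^sub>R B\<close> can be solved for \<open>B\<close>.\<close>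
  have "u \<bullet> (Y *v u) = d"
    using \<open>d > 0\<close> by (simp add: form d_def [symmetric] power2_eq_square)
  then have "c \<noteq> 0"
    using c \<open>d > 0\<close> by auto
  then have "B = (1 / c) *\<^sub>R Y"
    by (simp add: c)
  then have "B = (1 / (c * d)) *\<^sub>R outer (B *v u)"
    by (simp add: Y_def)
  then show ?thesis
    by (rule that)
qed

text \<open>A vanishing form is positive semi-definite with every vector isotropic, so every vector
  lies in the kernel. This replaces polarization.\<close>

lemma sym_mats_form_eq_0:
  assumes A: "A \<in> sym_mats" and form: "\<And>u. u \<bullet> (A *v u) = 0"
  shows "A = 0"
proof -
  have "A \<in> pos_semidef_mats"
    using assms by (simp add: pos_semidef_mats_def)
  then have "A *v u = 0" for u
    using pos_semidef_kernel form by blast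
  then show ?thesis
    by (simp add: matrix_eq)
qed

text \<open>One step of Lagrange's reduction of a quadratic form: for \<open>u\<close> with nonzero
  form, subtracting a multiple of \<open>outer (A *v u)\<close> gives a matrix that kills
  \<open>u\<close>. Its range stays inside that of \<open>A\<close> but loses
  \<open>A *v u\<close>.\<close>

lemma sym_mats_rank_reduce:
  fixes A :: "real^'n^'n"
  assumes A: "A \<in> sym_mats" and "A \<noteq> 0"
  obtains c w where "rank (A - c *\<^sub>R outer w) < rank A"
proof -
  obtain u where u: "u \<bullet> (A *v u) \<noteq> 0"
    using assms sym_mats_form_eq_0 by blast
  define w where "w = A *v u"
  define c where "c = 1 / (u \<bullet> w)"
  define A' where "A' = A - c *\<^sub>R outer w"
  have mult: "A' *v x = A *v (x - (c * (w \<bullet> x)) *\<^sub>R u)" for x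
    by (simp add: A'_def w_def matrix_vector_mult_diff_rdistrib outer_mult_vec
        matrix_vector_mult_diff_distrib matrix_vector_mult_scaleR
        scaleR_matrix_vector_assoc [symmetric])
  have "range ((*v) A') \<subseteq> range ((*v) A)"
    by (auto simp: mult)
  moreover have "w \<notin> range ((*v) A')"
  proof
    assume "w \<in> range ((*v) A')"
    then obtain x where "w = A' *v x"
      by auto
    \<comment> \<open>The choice of \<open>c\<close> makes the range of \<open>A'\<close> orthogonal
      to \<open>u\<close>, whereas \<open>u \<bullet> w\<close> is nonzero.\<close>
    moreover have "u \<bullet> (A' *v x) = 0"
      using u sym_mats_inner [OF A, of u x]
      by (simp add: A'_def c_def w_def matrix_vector_mult_diff_rdistrib outer_mult_vec
          inner_diff_right scaleR_matrix_vector_assoc [symmetric])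
    ultimately show False
      using u by (simp add: w_def)
  qed
  moreover have "w \<in> range ((*v) A)"
    by (simp add: w_def)
  ultimately have "range ((*v) A') \<subset> range ((*v) A)"
    by blast
  \<comment> \<open>Ranges are subspaces, so their strict inclusion is one of spans and lowers the
    dimension.\<close>
  moreover have "span (range ((*v) B)) = range ((*v) B)" for B :: "real^'n^'n"
    unfolding span_eq_iff
    by (intro linear_subspace_image matrix_vector_mul_linear subspace_UNIV)
  ultimately have "dim (range ((*v) A')) < dim (range ((*v) A))"
    by (intro dim_psubset) (simp only:)
  then show ?thesis
    using that by (simp add: rank_dim_range A'_def)
qed

section \<open>Linear operators on symmetric matrices\<close>

locale pos_def_preserver =
  fixes T :: "real^'n^'n \<Rightarrow> real^'n^'n"
  assumes linear_on_sym: "linear_on_sym T"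
    and preserves_pos_def: "preserves_pos_def T"
begin

lemma T_sym: "A \<in> sym_mats \<Longrightarrow> T A \<in> sym_mats"
  and T_add: "A \<in> sym_mats \<Longrightarrow> B \<in> sym_mats \<Longrightarrow> T (A + B) = T A + T B"
  and T_scaleR: "A \<in> sym_mats \<Longrightarrow> T (c *\<^sub>R A) = c *\<^sub>R T A"
  using linear_on_sym by (auto simp: linear_on_sym_def)

lemma T_diff: "A \<in> sym_mats \<Longrightarrow> B \<in> sym_mats \<Longrightarrow> T (A - B) = T A - T B"
  using T_add [of "A - B" B] by (simp add: sym_mats_diff)

lemma T_pos_def: "A \<in> pos_def_mats \<Longrightarrow> T A \<in> pos_def_mats"
  using preserves_pos_def by (simp add: preserves_pos_def_def)

lemma T_add_one: "A \<in> sym_mats \<Longrightarrow> T (A + e *\<^sub>R mat 1) = T A + e *\<^sub>R T (mat 1)"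
  by (simp add: T_add T_scaleR sym_mats_scaleR sym_mats_mat)

text \<open>\<open>A\<close> is a limit of the positive definite matrices
  \<open>A + e *\<^sub>R mat 1\<close>, and the cone is closed.\<close>

lemma T_pos_semidef:
  assumes "A \<in> pos_semidef_mats"
  shows "T A \<in> pos_semidef_mats"
proof (rule pos_semidef_if_perturbation)
  have A: "A \<in> sym_mats"
    using assms by (rule pos_semidef_imp_sym)
  then show "T A \<in> sym_mats"
    by (rule T_sym)
  fix e :: real
  assume "e > 0"
  then have "T (A + e *\<^sub>R mat 1) \<in> pos_def_mats"
    by (intro T_pos_def pos_semidef_add_pos_def assms pos_def_scaleR pos_def_one)
  then show "T A + e *\<^sub>R T (mat 1) \<in> pos_semidef_mats"
    by (simp add: T_add_one A pos_def_imp_pos_semidef)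
qed

text \<open>
  The extension of \<open>T\<close> by the identity on skew-symmetric matrices is an endomorphism of the full
  matrix space, where injectivity and surjectivity are equivalent.
\<close>

definition extension :: "real^'n^'n \<Rightarrow> real^'n^'n" where
  "extension A = T ((1/2) *\<^sub>R (A + transpose A)) + (1/2) *\<^sub>R (A - transpose A)"

lemma sym_part: "(1/2) *\<^sub>R (A + transpose A) \<in> sym_mats"
  by (simp add: sym_mats_def transpose_def vec_eq_iff)

lemma linear_extension: "linear extension"
proof (rule linearI)
  fix A B :: "real^'n^'n" and c :: real
  have "(1/2) *\<^sub>R ((A + B) + transpose (A + B)) =
      (1/2) *\<^sub>R (A + transpose A) + (1/2) *\<^sub>R (B + transpose B)"
    by (simp add: transpose_def vec_eq_iff field_simps)
  moreover have "(1/2) *\<^sub>R ((A + B) - transpose (A + B)) =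
      (1/2) *\<^sub>R (A - transpose A) + (1/2) *\<^sub>R (B - transpose B)"
    by (simp add: transpose_def vec_eq_iff field_simps)
  ultimately show "extension (A + B) = extension A + extension B"
    unfolding extension_def using T_add [OF sym_part sym_part, of A B] by simp
  have "(1/2) *\<^sub>R (c *\<^sub>R A + transpose (c *\<^sub>R A)) = c *\<^sub>R ((1/2) *\<^sub>R (A + transpose A))"
    by (simp add: transpose_def vec_eq_iff field_simps)
  moreover have "(1/2) *\<^sub>R (c *\<^sub>R A - transpose (c *\<^sub>R A)) = c *\<^sub>R ((1/2) *\<^sub>R (A - transpose A))"
    by (simp add: transpose_def vec_eq_iff field_simps)
  ultimately show "extension (c *\<^sub>R A) = c *\<^sub>R extension A"
    unfolding extension_def using T_scaleR [OF sym_part, of c A] by (simp add: scaleR_add_right)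
qed

lemma extension_sym: "A \<in> sym_mats \<Longrightarrow> extension A = T A"
proof -
  assume "A \<in> sym_mats"
  then have "transpose A = A"
    by (simp add: sym_mats_def)
  then show ?thesis
    by (simp add: extension_def scaleR_2 [symmetric])
qed

text \<open>The skew-symmetric part of \<open>A\<close> passes unchanged into
  \<open>extension A\<close>; if the latter is symmetric, that part is both symmetric and
  skew-symmetric, hence zero.\<close>

lemma extension_in_sym_imp:
  assumes "extension A \<in> sym_mats"
  shows "A \<in> sym_mats"
proof -
  have "extension A - T ((1/2) *\<^sub>R (A + transpose A)) \<in> sym_mats"
    by (intro sym_mats_diff assms T_sym sym_part)
  then have "transpose ((1/2) *\<^sub>R (A - transpose A)) = (1/2) *\<^sub>R (A - transpose A)"
    by (simp add: extension_def sym_mats_def)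
  then have "(1/2) * (A $ i $ j - A $ j $ i) = (1/2) * (A $ j $ i - A $ i $ j)" for i j
    by (drule_tac arg_cong [where f = "\<lambda>M. M $ j $ i"]) (simp add: transpose_def)
  then have "A $ i $ j - A $ j $ i = A $ j $ i - A $ i $ j" for i j
    by simp
  then have "A $ i $ j = A $ j $ i" for i j
    by (metis diff_gt_0_iff_gt less_asym linorder_neqE_linordered_idom)
  then show ?thesis
    by (simp add: sym_mats_def transpose_def vec_eq_iff)
qed

text \<open>The kernel of \<open>extension\<close> consists of symmetric matrices, so it is trivial
  too, and \<open>extension\<close> is onto by finite dimension. Preimages of symmetric matrices are
  again symmetric.\<close>

lemma surj_on_sym_if_kernel:
  assumes "\<And>A. A \<in> sym_mats \<Longrightarrow> T A = 0 \<Longrightarrow> A = 0"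
  shows "T ` sym_mats = sym_mats"
proof -
  have "A = 0" if "extension A = 0" for A
  proof -
    have "A \<in> sym_mats"
      using that by (simp add: extension_in_sym_imp zero_sym_mats)
    moreover from this have "T A = 0"
      using that by (simp add: extension_sym)
    ultimately show ?thesis
      by (rule assms)
  qed
  then have "inj extension"
    by (simp add: linear_injective_0 [OF linear_extension])
  then have "surj extension"
    by (intro linear_injective_imp_surjective [OF linear_extension]) simp_all
  have "B \<in> T ` sym_mats" if "B \<in> sym_mats" for B
  proof -
    obtain A where "B = extension A"
      using \<open>surj extension\<close> by (metis surjD)
    moreover from this have "A \<in> sym_mats"
      using that by (simp add: extension_in_sym_imp)
    ultimately show ?thesis
      by (simp add: extension_sym)
  qed
  then show ?thesis
    using T_sym by auto
qed

lemma inj_on_sym_if_surj: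
  assumes "T ` sym_mats = sym_mats"
  shows "inj_on T sym_mats"
proof -
  have "B \<in> range extension" for B
  proof -
    have "(1/2) *\<^sub>R (B + transpose B) \<in> T ` sym_mats"
      using sym_part assms by simp
    then obtain A where A: "A \<in> sym_mats" "(1/2) *\<^sub>R (B + transpose B) = T A"
      by auto
    \<comment> \<open>The skew-symmetric part of \<open>B\<close> is fixed by
      \<open>extension\<close>, so it can be added to a preimage of the symmetric part.\<close>
    define K where "K = (1/2) *\<^sub>R (B - transpose B)"
    have "(1/2) *\<^sub>R (K + transpose K) = 0" "(1/2) *\<^sub>R (K - transpose K) = K"
      by (simp_all add: K_def transpose_def vec_eq_iff field_simps)
    moreover have "T 0 = 0"
      using T_scaleR [OF sym_mats_mat, of 0 0] by simp
    ultimately have "extension K = K"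
      by (simp only: extension_def) simp
    then have "extension (A + K) = T A + K"
      using A by (simp add: linear_add [OF linear_extension] extension_sym)
    also have "\<dots> = B"
      unfolding A(2) [symmetric] K_def by (simp add: vec_eq_iff transpose_def field_simps)
    finally show ?thesis
      by (metis rangeI)
  qed
  then have "surj extension"
    by blast
  then have "inj extension"
    by (intro linear_surjective_imp_injective [OF linear_extension]) simp_all
  then show ?thesis
    by (metis extension_sym injD inj_onI)
qed

section \<open>Criteria for reflecting positive definiteness\<close>

lemma reflects_pos_def_if_singular:
  assumes "\<And>A. A \<in> pos_semidef_mats \<Longrightarrow> \<not> invertible A \<Longrightarrow> T A \<notin> pos_def_mats"
  shows "sym_preimage T pos_def_mats \<subseteq> pos_def_mats"
proof
  fix A
  assume "A \<in> sym_preimage T pos_def_mats"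
  then have A: "A \<in> sym_mats" "T A \<in> pos_def_mats"
    by (auto simp: sym_preimage_def)
  obtain m where m: "A - m *\<^sub>R mat 1 \<in> pos_semidef_mats" "\<not> invertible (A - m *\<^sub>R mat 1)"
    using singular_pos_semidef_shift [OF A(1)] .
  show "A \<in> pos_def_mats"
  proof (cases "m > 0")
    case True
    have "(A - m *\<^sub>R mat 1) + m *\<^sub>R mat 1 \<in> pos_def_mats"
      using True by (intro pos_semidef_add_pos_def m pos_def_scaleR pos_def_one)
    then show ?thesis
      by simp
  next
    case False
    \<comment> \<open>For \<open>m \<le> 0\<close> the shifted matrix has positive definite image
      although it is singular and positive semi-definite, contrary to the assumption. The case
      \<open>m = 0\<close> is apart because scaling needs a strictly positive factor.\<close>
    have "T A + (- m) *\<^sub>R T (mat 1) \<in> pos_def_mats"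
    proof (cases "m = 0")
      case True
      then show ?thesis
        using A by simp
    next
      case False
      with \<open>\<not> m > 0\<close> show ?thesis
        by (intro pos_semidef_add_pos_def pos_def_imp_pos_semidef A pos_def_scaleR
            T_pos_def pos_def_one) simp
    qed
    then have "T (A - m *\<^sub>R mat 1) \<in> pos_def_mats"
      using T_add_one [OF A(1), of "- m"] by simp
    then show ?thesis
      using assms m by blast
  qed
qed

text \<open>Differences of positive definite matrices exhaust the symmetric ones, so
  \<open>T\<close> is onto there and hence injective. A symmetric matrix with positive definite
  image thus equals the positive definite preimage of that image.\<close>

lemma reflects_pos_def_if_image:
  assumes "T ` pos_def_mats = pos_def_mats"
  shows "sym_preimage T pos_def_mats \<subseteq> pos_def_mats"
proof -
  have "B \<in> T ` sym_mats" if B: "B \<in> sym_mats" for B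
  proof -
    obtain C D where "C \<in> pos_def_mats" "D \<in> pos_def_mats" "B = C - D"
      using sym_mats_eq_diff_pos_def [OF B] .
    moreover from this obtain C' D' where "C' \<in> pos_def_mats" "D' \<in> pos_def_mats"
        "C = T C'" "D = T D'"
      using assms by (metis imageE)
    ultimately have "B = T (C' - D')" "C' - D' \<in> sym_mats"
      by (simp_all add: T_diff pos_def_imp_sym sym_mats_diff)
    then show ?thesis
      by blast
  qed
  then have "T ` sym_mats = sym_mats"
    using T_sym by auto
  then have inj: "inj_on T sym_mats"
    by (rule inj_on_sym_if_surj)
  show ?thesis
  proof
    fix A
    assume "A \<in> sym_preimage T pos_def_mats"
    then have A: "A \<in> sym_mats" "T A \<in> pos_def_mats"
      by (auto simp: sym_preimage_def)
    then obtain B where "B \<in> pos_def_mats" "T A = T B"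
      using assms by (metis imageE)
    then show "A \<in> pos_def_mats"
      using inj A by (metis inj_onD pos_def_imp_sym)
  qed
qed

end

section \<open>Automorphisms of the cone and their effect on rank\<close>

locale pos_def_automorphism = pos_def_preserver T for T :: "real^'n^'n \<Rightarrow> real^'n^'n" +
  assumes reflects: "sym_preimage T pos_def_mats \<subseteq> pos_def_mats"
begin

lemma reflects_pos_def: "A \<in> sym_mats \<Longrightarrow> T A \<in> pos_def_mats \<Longrightarrow> A \<in> pos_def_mats"
  using reflects by (auto simp: sym_preimage_def)

lemma reflects_pos_semidef:
  assumes A: "A \<in> sym_mats" and TA: "T A \<in> pos_semidef_mats"
  shows "A \<in> pos_semidef_mats"
  using A
proof (rule pos_semidef_if_perturbation)
  fix e :: real
  assume "e > 0"
  then have "T A + e *\<^sub>R T (mat 1) \<in> pos_def_mats"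
    by (intro pos_semidef_add_pos_def TA pos_def_scaleR T_pos_def pos_def_one)
  then have "T (A + e *\<^sub>R mat 1) \<in> pos_def_mats"
    by (simp add: T_add_one A)
  then have "A + e *\<^sub>R mat 1 \<in> pos_def_mats"
    by (rule reflects_pos_def [OF sym_mats_add [OF A sym_mats_scaleR [OF sym_mats_mat]]])
  then show "A + e *\<^sub>R mat 1 \<in> pos_semidef_mats"
    by (rule pos_def_imp_pos_semidef)
qed

text \<open>The cone is pointed: if \<open>T A = 0\<close>, both \<open>A\<close> and its negative
  have positive semi-definite image, so both are positive semi-definite.\<close>

lemma kernel_trivial:
  assumes A: "A \<in> sym_mats" and "T A = 0"
  shows "A = 0"
proof (rule sym_mats_form_eq_0 [OF A])
  have zero: "0 \<in> pos_semidef_mats"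
    by (simp add: pos_semidef_mats_def zero_sym_mats)
  have "T ((-1) *\<^sub>R A) = 0"
    by (simp only: T_scaleR [OF A] \<open>T A = 0\<close>) simp
  then have neg: "(-1) *\<^sub>R A \<in> pos_semidef_mats"
    using zero by (intro reflects_pos_semidef [OF sym_mats_scaleR [OF A]]) simp
  have pos: "A \<in> pos_semidef_mats"
    using zero \<open>T A = 0\<close> by (intro reflects_pos_semidef [OF A]) simp
  show "u \<bullet> (A *v u) = 0" for u
  proof -
    have "0 \<le> u \<bullet> (((-1) *\<^sub>R A) *v u)" "0 \<le> u \<bullet> (A *v u)"
      using neg pos unfolding pos_semidef_mats_def by blast+
    moreover have "u \<bullet> (((-1) *\<^sub>R A) *v u) = - (u \<bullet> (A *v u))"
      by (simp only: scaleR_matrix_vector_assoc [symmetric] inner_scaleR_right)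
    ultimately show ?thesis
      by linarith
  qed
qed

lemma surj_on_sym: "T ` sym_mats = sym_mats"
  by (rule surj_on_sym_if_kernel [OF kernel_trivial])

lemma image_pos_def: "T ` pos_def_mats = pos_def_mats"
proof
  show "T ` pos_def_mats \<subseteq> pos_def_mats"
    using T_pos_def by blast
  show "pos_def_mats \<subseteq> T ` pos_def_mats"
  proof
    fix B :: "real^'n^'n"
    assume B: "B \<in> pos_def_mats"
    then obtain A where "A \<in> sym_mats" "B = T A"
      using surj_on_sym pos_def_imp_sym by (metis imageE)
    then show "B \<in> T ` pos_def_mats"
      using B reflects_pos_def by blast
  qed
qed

lemma singular_pos_semidef:
  assumes "A \<in> pos_semidef_mats" "\<not> invertible A"
  shows "\<not> invertible (T A)"
proof
  assume "invertible (T A)"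
  then have "T A \<in> pos_def_mats"
    by (simp add: pos_def_iff T_pos_semidef assms(1))
  then have "A \<in> pos_def_mats"
    by (rule reflects_pos_def [OF pos_semidef_imp_sym [OF assms(1)]])
  then show False
    using assms(2) by (simp add: pos_def_iff)
qed

text \<open>Extremality is carried over by \<open>T\<close>: a matrix between 0 and
  \<open>T (outer w)\<close> pulls back to one between 0 and \<open>outer w\<close>, which is a
  multiple of \<open>outer w\<close>.\<close>

lemma T_outer:
  obtains c y where "T (outer w) = c *\<^sub>R outer y"
proof (rule pos_semidef_extreme_imp_outer)
  show "T (outer w) \<in> pos_semidef_mats"
    by (intro T_pos_semidef outer_pos_semidef)
  fix Y
  assume Y: "Y \<in> pos_semidef_mats" and le: "T (outer w) - Y \<in> pos_semidef_mats"
  obtain Z where Z: "Z \<in> sym_mats" "Y = T Z"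
    using surj_on_sym pos_semidef_imp_sym [OF Y] by (metis imageE)
  have "Z \<in> pos_semidef_mats"
    using Z Y by (simp add: reflects_pos_semidef)
  moreover have "outer w - Z \<in> pos_semidef_mats"
    using Z le by (intro reflects_pos_semidef [OF sym_mats_diff])
      (simp_all add: T_diff outer_sym)
  ultimately obtain c where "Z = c *\<^sub>R outer w"
    by (rule pos_semidef_le_outer)
  then show "\<exists>c. Y = c *\<^sub>R T (outer w)"
    using Z by (auto simp: T_scaleR outer_sym)
qed (rule that)

text \<open>Induction on the rank: each rank-reducing step splits off a multiple of some
  \<open>outer w\<close>, whose image under \<open>T\<close> contributes at most one spanning
  vector.\<close>

lemma range_T_in_span:
  assumes "A \<in> sym_mats"
  shows "\<exists>S. finite S \<and> card S \<le> rank A \<and> range ((*v) (T A)) \<subseteq> span S"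
  using assms
proof (induction "rank A" arbitrary: A rule: less_induct)
  case less
  show ?case
  proof (cases "A = 0")
    case True
    have "T A = 0"
      using T_scaleR [OF \<open>A \<in> sym_mats\<close>, of 0] True by simp
    then show ?thesis
      by (intro exI [of _ "{}"]) auto
  next
    case False
    then obtain c w where rank: "rank (A - c *\<^sub>R outer w) < rank A"
      using sym_mats_rank_reduce less.prems by blast
    have sym: "A - c *\<^sub>R outer w \<in> sym_mats"
      by (intro sym_mats_diff sym_mats_scaleR outer_sym less.prems)
    obtain S where S: "finite S" "card S \<le> rank (A - c *\<^sub>R outer w)"
        "range ((*v) (T (A - c *\<^sub>R outer w))) \<subseteq> span S"
      using less.hyps [OF rank sym] by blast
    obtain d y where "T (outer w) = d *\<^sub>R outer y"
      by (rule T_outer)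
    then have "T A = T (A - c *\<^sub>R outer w) + (c * d) *\<^sub>R outer y"
      by (simp add: T_diff T_scaleR outer_sym sym_mats_scaleR less.prems)
    then have eq: "T A *v x = T (A - c *\<^sub>R outer w) *v x + (c * d * (y \<bullet> x)) *\<^sub>R y" for x
      by (simp add: matrix_vector_mult_add_rdistrib scaleR_matrix_vector_assoc [symmetric]
          outer_mult_vec)
    have "T A *v x \<in> span (insert y S)" for x
      unfolding eq
    proof (intro span_add span_scale)
      show "T (A - c *\<^sub>R outer w) *v x \<in> span (insert y S)"
        using S(3) span_mono [of S "insert y S"] by blast
    qed (simp add: span_base)
    \<comment> \<open>The new vector is paid for by the strict drop in rank.\<close>
    moreover have "card (insert y S) \<le> rank A"
      using S rank card_insert_le_m1 [of "rank A" S y] by simp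
    ultimately show ?thesis
      using S(1) by (intro exI [of _ "insert y S"]) auto
  qed
qed

lemma rank_T_le:
  assumes "A \<in> sym_mats"
  shows "rank (T A) \<le> rank A"
proof -
  obtain S where S: "finite S" "card S \<le> rank A" "range ((*v) (T A)) \<subseteq> span S"
    using range_T_in_span [OF assms] by (elim exE conjE) (rule that)
  then have "rank (T A) \<le> card S"
    unfolding rank_dim_range by (intro dim_le_card)
  with S(2) show ?thesis
    by (rule order_trans [rotated])
qed

text \<open>The rank of \<open>A\<close> is squeezed between that of \<open>T A\<close>, which is
  full, and the size of the matrix.\<close>

lemma reflects_invertible:
  assumes A: "A \<in> sym_mats" and inv: "invertible (T A)"
  shows "invertible A"
proof -
  have full: "invertible B \<longleftrightarrow> rank B = CARD('n)" for B :: "real^'n^'n"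
    unfolding invertible_left_inverse matrix_left_invertible_injective full_rank_injective ..
  have "rank (T A) = CARD('n)"
    using inv by (rule full [THEN iffD1])
  with rank_T_le [OF A] rank_bound [of A] have "rank A = CARD('n)"
    by simp
  then show ?thesis
    by (rule full [THEN iffD2])
qed

end

theorem corollary13:
  fixes T :: "real^'n^'n \<Rightarrow> real^'n^'n"
  assumes "linear_on_sym T"
    and "preserves_pos_def T"
  shows "(sym_preimage T pos_def_mats \<subseteq> pos_def_mats \<longleftrightarrow>
            sym_preimage T invertible_sym_mats \<subseteq> invertible_sym_mats) \<and>
         (sym_preimage T pos_def_mats \<subseteq> pos_def_mats \<longleftrightarrow>
            (\<forall>A\<in>sym_mats. \<not> invertible A \<and> A \<in> pos_semidef_mats \<longrightarrow>
               \<not> invertible (T A) \<and> T A \<in> pos_semidef_mats)) \<and>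
         (sym_preimage T pos_def_mats \<subseteq> pos_def_mats \<longleftrightarrow>
            T ` pos_def_mats = pos_def_mats)"
proof -
  interpret pos_def_preserver T
    using assms by unfold_locales
  let ?reflects = "sym_preimage T pos_def_mats \<subseteq> pos_def_mats"
  let ?singular = "\<forall>A\<in>sym_mats. \<not> invertible A \<and> A \<in> pos_semidef_mats \<longrightarrow>
               \<not> invertible (T A) \<and> T A \<in> pos_semidef_mats"
  have "sym_preimage T invertible_sym_mats \<subseteq> invertible_sym_mats \<and> ?singular \<and>
      T ` pos_def_mats = pos_def_mats" if ?reflects
  proof -
    interpret pos_def_automorphism T
      using that by unfold_locales
    show ?thesis
    proof (intro conjI)
      show "sym_preimage T invertible_sym_mats \<subseteq> invertible_sym_mats"
        unfolding sym_preimage_def invertible_sym_mats_def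
        using reflects_invertible by blast
      show ?singular
        using singular_pos_semidef T_pos_semidef by blast
    qed (rule image_pos_def)
  qed
  moreover have ?reflects if "sym_preimage T invertible_sym_mats \<subseteq> invertible_sym_mats"
  proof (rule reflects_pos_def_if_singular)
    fix A :: "real^'n^'n"
    assume "A \<in> pos_semidef_mats" "\<not> invertible A"
    \<comment> \<open>A positive definite \<open>T A\<close> would be invertible, which would force
      \<open>A\<close> to be invertible.\<close>
    then show "T A \<notin> pos_def_mats"
      using that pos_semidef_imp_sym [of A] T_sym [of A]
      by (auto simp: sym_preimage_def invertible_sym_mats_def pos_def_iff)
  qed
  moreover have ?reflects if ?singular
    using that by (intro reflects_pos_def_if_singular) (simp add: pos_def_iff pos_semidef_imp_sym)
  moreover have ?reflects if "T ` pos_def_mats = pos_def_mats"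
    using that by (rule reflects_pos_def_if_image)
  ultimately show ?thesis
    by argo
qed

end
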